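(* Let $X$ (exposure), $Y$ (outcome), $A$ (a finite set of covariates, the candidate adjustment set) and $S$ (selection) be variables of a causal directed acyclic graph $\mathcal{G}$ satisfying Assumptions 1--5 stated in the context. All (in)dependence statements and all statements about open paths and valid adjustment sets are understood within the selected sample, i.e. with $S$ conditioned on in addition to the listed variables. Let $Z=\{Z_j\}_{j=1}^{J}$ be a non-empty subset of $A$ and write $A_j^*=A\setminus\{Z_j\}$. Suppose that, for every $j=1,\dots,J$, $Z_j$ and $X$ are dependent conditional on $A_j^*$. Then: (1) If $Z_j$ and $Y$ are dependent conditional on $A_j^*\cup\{X\}$ for all $j=1,\dots,J$, then either $A$ is an invalid adjustment set, or $A$ is a minimally sufficient adjustment set in the following sense: for all $j=1,\dots,J$, given adjustment for $A_j^*$, there is no confounding if and only if $Z_j$ is additionally adjusted for (that is, $A=A_j^*\cup\{Z_j\}$ is a valid adjustment set while $A_j^*$ is not). (2) Otherwise, i.e. if $Z_j$ and $Y$ are independent conditional on $A_j^*\cup\{X\}$ for at least one $j\in\{1,\dots,J\}$, then $A$ is a valid (but non-minimal) adjustment set, and, for such $j$, $A_j^*$ is also a valid (possibly, but not necessarily, minimal) adjustment set.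
   Context: Setting. The data are generated by an acyclic causal model with directed acyclic graph $\mathcal{G}$, otherwise unspecified. Its nodes include the exposure $X$, the outcome $Y$, the finitely many covariates forming the candidate adjustment set $A$ (with $X,Y\notin A$), a selection node $S$ (indicating selection into the analytical sample, which is always conditioned on; $S\notin A\cup\{X,Y\}$, and $S$ may be isolated if there is no selection), and possibly other, unmeasured variables. "$U$ causes $V$" means there is a directed path from $U$ to $V$ in $\mathcal{G}$. Paths. A path between two nodes is open given a conditioning set $W$ if every non-collider on it is outside $W$ and every collider on it is in $W$ or has a descendant in $W$; otherwise it is blocked. Two nodes are d-connected given $W$ if there is an open path between them given $W$, and d-separated otherwise. A backdoor path between $X$ and $Y$ is a path between $X$ and $Y$ whose edge at $X$ points into $X$. Confounding (given adjustment for a set $B$) means existence of a backdoor path between $X$ and $Y$ that is open given $B\cup\{S\}$. A set of covariates $B\subseteq A$ is a valid adjustment set if there is no confounding given adjustment for $B$, i.e. every backdoor path between $X$ and $Y$ is blocked given $B\cup\{S\}$; otherwise it is invalid. "Non-minimal" for a valid set means that some proper subset of it is also a valid adjustment set. Assumptions. Assumption 1: $Y$ is not a cause of $X$. Assumption 2: $X$ is measured without error (the variable $X$ that is conditioned on is the exposure node itself). Assumption 3: no element of $A$ is caused by $X$. Assumption 4: either $S$ is not caused by $X$, or $S$ is not associated, conditional on all other covariates $A\setminus\{Z\}$, with any covariate $Z\in A$ eligible for the test (i.e. any $Z\in A$ that is dependent with $X$ conditional on $A\setminus\{Z\}$). Assumption 5 (faithfulness): d-connection implies statistical dependence. Together with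 the usual Markov property (d-separation implies independence), two variables are conditionally dependent given a set of variables if and only if they are d-connected given that set (including sets containing the conditioned-on selection node $S$). *)

theory Defs
  imports "HOL-Probability.Probability"
begin

text \<open>
  A directed graph is given by its edge relation \<open>E\<close>; acyclicity is \<^const>\<open>acyclic\<close>, and a
  directed path of length at least one from \<open>u\<close> to \<open>v\<close> is \<open>(u, v) \<in> E\<^sup>+\<close>. Since an acyclic
  relation has no antiparallel edges, a path in the underlying undirected graph is determined by
  its list of (distinct) nodes.
\<close>

definition causes :: "('v \<times> 'v) set \<Rightarrow> 'v \<Rightarrow> 'v \<Rightarrow> bool" where
  "causes E u v \<longleftrightarrow> (u, v) \<in> E\<^sup>+"

definition is_path :: "('v \<times> 'v) set \<Rightarrow> 'v \<Rightarrow> 'v list \<Rightarrow> 'v \<Rightarrow> bool" where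
  "is_path E u p v \<longleftrightarrow>
     p \<noteq> [] \<and> hd p = u \<and> last p = v \<and> distinct p \<and>
     successively (\<lambda>a b. (a, b) \<in> E \<or> (b, a) \<in> E) p"

definition collider :: "('v \<times> 'v) set \<Rightarrow> 'v list \<Rightarrow> nat \<Rightarrow> bool" where
  "collider E p i \<longleftrightarrow>
     0 < i \<and> Suc i < length p \<and> (p ! (i - 1), p ! i) \<in> E \<and> (p ! Suc i, p ! i) \<in> E"

text \<open>The reflexive closure covers a collider that itself lies in the conditioning set.\<close>

definition open_path :: "('v \<times> 'v) set \<Rightarrow> 'v set \<Rightarrow> 'v list \<Rightarrow> bool" where
  "open_path E W p \<longleftrightarrow>
     (\<forall>i < length p. if collider E p i then \<exists>d \<in> W. (p ! i, d) \<in> E\<^sup>* else p ! i \<notin> W)"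

definition d_connected :: "('v \<times> 'v) set \<Rightarrow> 'v set \<Rightarrow> 'v \<Rightarrow> 'v \<Rightarrow> bool" where
  "d_connected E W u v \<longleftrightarrow> (\<exists>p. is_path E u p v \<and> open_path E W p)"

definition backdoor_path :: "('v \<times> 'v) set \<Rightarrow> 'v \<Rightarrow> 'v list \<Rightarrow> 'v \<Rightarrow> bool" where
  "backdoor_path E x p y \<longleftrightarrow> is_path E x p y \<and> 2 \<le> length p \<and> (p ! 1, p ! 0) \<in> E"

definition confounding :: "('v \<times> 'v) set \<Rightarrow> 'v \<Rightarrow> 'v \<Rightarrow> 'v \<Rightarrow> 'v set \<Rightarrow> bool" where
  "confounding E x y s B \<longleftrightarrow> (\<exists>p. backdoor_path E x p y \<and> open_path E (B \<union> {s}) p)"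

text \<open>Here \<open>A\<close> is the candidate set and \<open>s\<close> is the selection node.\<close>

definition valid_adjustment ::
    "('v \<times> 'v) set \<Rightarrow> 'v \<Rightarrow> 'v \<Rightarrow> 'v \<Rightarrow> 'v set \<Rightarrow> 'v set \<Rightarrow> bool" where
  "valid_adjustment E x y s A B \<longleftrightarrow> B \<subseteq> A \<and> \<not> confounding E x y s B"

text \<open>
  The random variable attached to node \<open>v\<close> is \<open>R v\<close>, with values in the measurable space \<open>N v\<close>.
  The conditioning \<open>\<sigma>\<close>-algebra is the one generated jointly by the variables in \<open>W\<close>.
\<close>

definition generated_algebra ::
    "'w measure \<Rightarrow> ('v \<Rightarrow> 'b measure) \<Rightarrow> ('v \<Rightarrow> 'w \<Rightarrow> 'b) \<Rightarrow> 'v set \<Rightarrow> 'w measure" where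
  "generated_algebra M N R W =
     vimage_algebra (space M) (\<lambda>\<omega>. \<lambda>w\<in>W. R w \<omega>) (\<Pi>\<^sub>M w\<in>W. N w)"

definition cond_indep ::
    "'w measure \<Rightarrow> ('v \<Rightarrow> 'b measure) \<Rightarrow> ('v \<Rightarrow> 'w \<Rightarrow> 'b) \<Rightarrow> 'v set \<Rightarrow> 'v \<Rightarrow> 'v \<Rightarrow> bool" where
  "cond_indep M N R W u v \<longleftrightarrow>
     (\<forall>B \<in> sets (N u). \<forall>C \<in> sets (N v).
        let F = generated_algebra M N R W;
            P = (\<lambda>D. real_cond_exp M F (indicator D));
            EB = R u -` B \<inter> space M;
            EC = R v -` C \<inter> space M
        in AE \<omega> in M. P (EB \<inter> EC) \<omega> = P EB \<omega> * P EC \<omega>)"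

abbreviation cond_dep ::
    "'w measure \<Rightarrow> ('v \<Rightarrow> 'b measure) \<Rightarrow> ('v \<Rightarrow> 'w \<Rightarrow> 'b) \<Rightarrow> 'v set \<Rightarrow> 'v \<Rightarrow> 'v \<Rightarrow> bool" where
  "cond_dep M N R W u v \<equiv> \<not> cond_indep M N R W u v"

text \<open>
  Of the causal model only the graph, the joint distribution of the node variables and the Markov
  property are recorded. The node set is not required to be finite, but conditioning sets are.
\<close>

locale causal_model = prob_space M
  for M :: "'w measure" and N :: "'v \<Rightarrow> 'b measure" and R :: "'v \<Rightarrow> 'w \<Rightarrow> 'b"
    and V :: "'v set" and E :: "('v \<times> 'v) set" +
  assumes edges: "E \<subseteq> V \<times> V"
    and dag: "acyclic E"
    and node_measurable: "\<And>v. v \<in> V \<Longrightarrow> R v \<in> measurable M (N v)"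
    and markov: "\<And>u v W. \<lbrakk>u \<in> V; v \<in> V; u \<noteq> v; finite W; W \<subseteq> V - {u, v}; \<not> d_connected E W u v\<rbrakk>
                   \<Longrightarrow> cond_indep M N R W u v"

definition faithful ::
    "'w measure \<Rightarrow> ('v \<Rightarrow> 'b measure) \<Rightarrow> ('v \<Rightarrow> 'w \<Rightarrow> 'b) \<Rightarrow> 'v set \<Rightarrow> ('v \<times> 'v) set \<Rightarrow> bool" where
  "faithful M N R V E \<longleftrightarrow>
     (\<forall>u \<in> V. \<forall>v \<in> V. \<forall>W. u \<noteq> v \<longrightarrow> finite W \<longrightarrow> W \<subseteq> V - {u, v} \<longrightarrow>
        d_connected E W u v \<longrightarrow> cond_dep M N R W u v)"

end

theory Submission
  imports Defs
begin

text \<open>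
  By the Markov property and faithfulness, dependence is d-connection, so the claim is about the
  graph. Write \<open>W\<close> for \<open>A - {z} \<union> {S}\<close>. Every path from \<open>X\<close> to \<open>z\<close> open given \<open>W\<close> points into \<open>X\<close>:
  otherwise \<open>X\<close> would cause \<open>z\<close>, or a collider on the path, hence an element of \<open>A\<close>, or \<open>S\<close>,
  and in the last case \<open>S\<close> would be d-connected to \<open>z\<close> given \<open>A - {z}\<close>.

  For part (2), such a path and a backdoor path open given \<open>W\<close> meet at the collider \<open>X\<close> and connect
  \<open>z\<close> to \<open>Y\<close> given \<open>W \<union> {X}\<close>. A backdoor path that is open only once \<open>z\<close> is added to \<open>W\<close> has a last
  collider whose descendants in \<open>W \<union> {z}\<close> reduce to \<open>z\<close>; going from \<open>z\<close> back to this collider and on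
  to \<open>Y\<close> again connects \<open>z\<close> to \<open>Y\<close>.

  For part (1), a path from \<open>z\<close> to \<open>Y\<close> open given \<open>W \<union> {X}\<close> and not given \<open>W\<close> yields, by the same
  rerouting with \<open>X\<close> for \<open>z\<close>, a backdoor path open given \<open>W\<close>. If it is open given \<open>W\<close>, prepend the
  path from \<open>X\<close> to \<open>z\<close>: the resulting backdoor walk is open given \<open>W\<close> if \<open>z\<close> is not a collider
  on it, and given \<open>W \<union> {z}\<close> if \<open>z\<close> is one.
\<close>

section \<open>Open walks\<close>

abbreviation walk :: "('v \<times> 'v) set \<Rightarrow> 'v list \<Rightarrow> bool" where
  "walk E \<equiv> successively (\<lambda>a b. (a, b) \<in> E \<or> (b, a) \<in> E)"

text \<open>Checking consecutive triples instead of indices lets walks with repeated nodes be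
  reversed, split and glued by list recursion.\<close>

definition open_triple :: "('v \<times> 'v) set \<Rightarrow> 'v set \<Rightarrow> 'v \<Rightarrow> 'v \<Rightarrow> 'v \<Rightarrow> bool" where
  "open_triple E W a b c \<longleftrightarrow>
     (if (a, b) \<in> E \<and> (c, b) \<in> E then \<exists>d \<in> W. (b, d) \<in> E\<^sup>* else b \<notin> W)"

text \<open>Openness of a walk except for the condition that its endpoints are outside \<open>W\<close>.\<close>

fun inner_open :: "('v \<times> 'v) set \<Rightarrow> 'v set \<Rightarrow> 'v list \<Rightarrow> bool" where
  "inner_open E W (a # b # c # p) \<longleftrightarrow> open_triple E W a b c \<and> inner_open E W (b # c # p)"
| "inner_open E W p \<longleftrightarrow> True"

lemma inner_open_iff_nth:
  "inner_open E W p \<longleftrightarrow>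
     (\<forall>i. Suc (Suc i) < length p \<longrightarrow> open_triple E W (p ! i) (p ! Suc i) (p ! Suc (Suc i)))"
proof (induction E W p rule: inner_open.induct)
  case (1 E W a b c p)
  have split: "(\<forall>i. P i) \<longleftrightarrow> P 0 \<and> (\<forall>i. P (Suc i))" for P :: "nat \<Rightarrow> bool"
    by (metis nat.exhaust)
  show ?case
    by (subst split) (simp add: 1)
qed auto

lemma open_path_iff_inner_open:
  assumes "p \<noteq> []"
  shows "open_path E W p \<longleftrightarrow> hd p \<notin> W \<and> last p \<notin> W \<and> inner_open E W p"
proof
  assume op: "open_path E W p"
  have "hd p \<notin> W"
    using op assms by (auto simp: open_path_def collider_def hd_conv_nth dest: spec[where x=0])
  moreover have "last p \<notin> W"
    using op assms
    by (auto simp: open_path_def collider_def last_conv_nth dest: spec[where x="length p - 1"])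
  moreover have "inner_open E W p"
    unfolding inner_open_iff_nth
  proof (intro allI impI)
    fix i assume i: "Suc (Suc i) < length p"
    show "open_triple E W (p ! i) (p ! Suc i) (p ! Suc (Suc i))"
      using op[unfolded open_path_def, rule_format, of "Suc i"] i
      by (simp add: collider_def open_triple_def)
  qed
  ultimately show "hd p \<notin> W \<and> last p \<notin> W \<and> inner_open E W p" by blast
next
  assume op: "hd p \<notin> W \<and> last p \<notin> W \<and> inner_open E W p"
  show "open_path E W p"
    unfolding open_path_def
  proof (intro allI impI)
    fix i assume i: "i < length p"
    consider "i = 0" | "i = length p - 1" | j where "i = Suc j" "Suc (Suc j) < length p"
      using i by (cases i) force+
    then show "if collider E p i then \<exists>d\<in>W. (p ! i, d) \<in> E\<^sup>* else p ! i \<notin> W"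
    proof cases
      case 1
      then show ?thesis using op assms by (simp add: collider_def hd_conv_nth)
    next
      case 2
      then show ?thesis using op assms by (simp add: collider_def last_conv_nth)
    next
      case 3
      then show ?thesis
        using op[unfolded inner_open_iff_nth] by (simp add: collider_def open_triple_def)
    qed
  qed
qed

lemma open_triple_commute: "open_triple E W a b c \<longleftrightarrow> open_triple E W c b a"
  by (auto simp: open_triple_def)

lemma inner_open_append:
  "inner_open E W (xs @ a # b # ys) \<longleftrightarrow>
     inner_open E W (xs @ [a, b]) \<and> inner_open E W (a # b # ys)"
proof (induction xs)
  case (Cons x xs)
  then show ?case by (cases xs; cases "tl xs") auto
qed simp

lemma inner_open_append_triple:
  "inner_open E W (xs @ a # b # c # ys) \<longleftrightarrow>
     inner_open E W (xs @ [a, b]) \<and> open_triple E W a b c \<and> inner_open E W (b # c # ys)"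
  by (subst inner_open_append) simp

lemma inner_open_rev: "inner_open E W (rev p) \<longleftrightarrow> inner_open E W p"
proof (induction E W p rule: inner_open.induct)
  case (1 E W a b c p)
  then show ?case
    using inner_open_append_triple[of E W "rev p" c b a "[]"] open_triple_commute[of E W a b c]
    by auto
qed auto

lemma walk_rev: "walk E (rev p) \<longleftrightarrow> walk E p"
  by (simp add: successively_rev disj_commute)

lemma inner_open_suffix: "inner_open E W (xs @ ys) \<Longrightarrow> inner_open E W ys"
  by (induction xs) (auto elim: inner_open.elims)

lemma inner_open_prefix: "inner_open E W (xs @ ys) \<Longrightarrow> inner_open E W xs"
  by (metis inner_open_rev inner_open_suffix rev_append)

text \<open>Enlarging the conditioning set keeps colliders open; only an interior visit to
  \<open>t\<close> could become blocked.\<close>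

lemma inner_open_insert:
  assumes "inner_open E W p" "t \<notin> set (butlast (tl p))"
  shows "inner_open E (insert t W) p"
  using assms
  by (induction E W p rule: inner_open.induct) (auto simp: open_triple_def split: if_splits)

lemma inner_open_insert_notin_tl:
  assumes "inner_open E W p" "t \<notin> set (tl p)"
  shows "inner_open E (insert t W) p"
  using assms by (auto intro: inner_open_insert dest: in_set_butlastD)

section \<open>Directed stretches and loop removal\<close>

text \<open>The walk follows directed edges up to its first collider, which is open and so an
  ancestor of \<open>W\<close> or in it; without a collider it is directed to the end.\<close>

lemma walk_leaving_imp_causes:
  assumes "walk E (x # a # p)" "inner_open E W (x # a # p)" "(x, a) \<in> E"
  shows "(x, last (a # p)) \<in> E\<^sup>+ \<or> (\<exists>d\<in>W. (x, d) \<in> E\<^sup>+)"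
  using assms
proof (induction p arbitrary: x a)
  case (Cons b p)
  show ?case
  proof (cases "(b, a) \<in> E")
    case True
    then show ?thesis
      using Cons.prems by (auto simp: open_triple_def intro: rtrancl_into_trancl2)
  next
    case False
    then have "(a, last (b # p)) \<in> E\<^sup>+ \<or> (\<exists>d\<in>W. (a, d) \<in> E\<^sup>+)"
      using Cons.prems by (intro Cons.IH) auto
    then show ?thesis
      using Cons.prems(3) by (auto intro: trancl_into_trancl2)
  qed
qed auto

text \<open>
  A loop \<open>v # ys @ [v]\<close> is cut out. If \<open>v\<close> becomes a collider without having been one, the loop
  leaves \<open>v\<close> through an outgoing edge, hence meets a collider that is a descendant of \<open>v\<close>.
\<close>

lemma open_triple_cut_loop:
  assumes "acyclic E" "walk E (xs @ a # v # ys @ v # c # zs)"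
    "inner_open E W (xs @ a # v # ys @ v # c # zs)"
  shows "open_triple E W a v c"
proof -
  have "(v, v) \<notin> E"
    using assms(1) by (auto simp: acyclic_def)
  then have "ys \<noteq> []"
    using assms(2) by (auto simp: successively_append_iff)
  then obtain s ys1 e ys2 where s: "ys = s # ys1" and e: "ys = ys2 @ [e]"
    by (metis neq_Nil_conv rev_exhaust)
  have eq: "xs @ a # v # ys @ v # c # zs = (xs @ [a]) @ (v # ys @ [v]) @ c # zs"
    by simp
  have w: "walk E (v # ys @ [v])"
    using assms(2) unfolding eq successively_append_iff by blast
  have ow: "inner_open E W (v # ys @ [v])"
    using assms(3) unfolding eq by (blast dest: inner_open_prefix inner_open_suffix)
  have t1: "open_triple E W a v s"
    using assms(3) inner_open_append_triple[of E W xs a v s "ys1 @ v # c # zs"]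
    by (simp add: s)
  have t2: "open_triple E W e v c"
    using assms(3) inner_open_append_triple[of E W "xs @ a # v # ys2" e v c zs]
    by (simp add: e)
  show ?thesis
  proof (cases "(s, v) \<in> E \<or> \<not> ((a, v) \<in> E \<and> (c, v) \<in> E)")
    case True
    then show ?thesis using t1 t2 by (auto simp: open_triple_def split: if_splits)
  next
    case False
    then have "(v, s) \<in> E" using w by (auto simp: s)
    then have "(v, v) \<in> E\<^sup>+ \<or> (\<exists>d\<in>W. (v, d) \<in> E\<^sup>+)"
      using walk_leaving_imp_causes[of E v s "ys1 @ [v]" W] w ow by (simp add: s)
    then show ?thesis
      using False assms(1) by (auto simp: open_triple_def acyclic_def intro: trancl_into_rtrancl)
  qed
qed

text \<open>Loops are cut out one at a time. The clause on \<open>take 2\<close> retains the first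
  edge, which is what makes a path a backdoor path.\<close>

lemma walk_imp_path:
  assumes "acyclic E" "p \<noteq> []" "walk E p" "inner_open E W p"
  shows "\<exists>p'. p' \<noteq> [] \<and> distinct p' \<and> walk E p' \<and> inner_open E W p' \<and> hd p' = hd p \<and>
           last p' = last p \<and> (hd p \<notin> set (tl p) \<longrightarrow> take 2 p' = take 2 p)"
  using assms(2-)
proof (induction "length p" arbitrary: p rule: less_induct)
  case less
  show ?case
  proof (cases "distinct p")
    case True
    then show ?thesis using less.prems by blast
  next
    case False
    then obtain xs v ys zs where p: "p = xs @ [v] @ ys @ [v] @ zs"
      using not_distinct_decomp by blast
    define q where "q = xs @ [v] @ zs"
    have "walk E q"
      using less.prems(2) unfolding p q_def
      by (cases zs) (auto simp: successively_append_iff successively_Cons)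
    moreover have "inner_open E W q"
    \<comment> \<open>If one side is empty, \<open>v\<close> is an endpoint of \<open>q\<close> and
      cutting creates no new triple.\<close>
    proof (cases "xs = [] \<or> zs = []")
      case True
      then show ?thesis
        using less.prems(3) inner_open_suffix[of E W "xs @ [v] @ ys" "[v] @ zs"]
          inner_open_prefix[of E W "xs @ [v]" "ys @ [v] @ zs"]
        unfolding p q_def by auto
    next
      case False
      then obtain xs' a c zs' where xz: "xs = xs' @ [a]" "zs = c # zs'"
        by (metis neq_Nil_conv rev_exhaust)
      have "open_triple E W a v c"
        using open_triple_cut_loop[of E xs' a v ys c zs' W] less.prems(2,3) assms(1)
        unfolding p xz by simp
      then show ?thesis
        using less.prems(3) inner_open_suffix[of E W "xs @ [v] @ ys" "[v] @ zs"]
          inner_open_prefix[of E W "xs @ [v]" "ys @ [v] @ zs"]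
          inner_open_append_triple[of E W xs' a v c zs']
        unfolding p q_def xz by auto
    qed
    moreover have "hd q = hd p" "last q = last p" "q \<noteq> []" "length q < length p"
      unfolding p q_def by (cases xs; auto)+
    \<comment> \<open>Since the head does not recur, \<open>v\<close> is not the head, so
      \<open>p\<close> and \<open>q\<close> share the prefix \<open>xs @ [v]\<close> of length at
      least 2.\<close>
    moreover have "hd p \<notin> set (tl p) \<Longrightarrow> take 2 q = take 2 p \<and> hd q \<notin> set (tl q)"
      unfolding p q_def by (cases xs; cases "tl xs") auto
    ultimately show ?thesis
      using less.hyps[of q] by auto
  qed
qed

section \<open>d-connection and confounding through walks\<close>

lemma d_connected_iff_walk:
  assumes "acyclic E"
  shows "d_connected E W u v \<longleftrightarrow>
    (\<exists>p. p \<noteq> [] \<and> hd p = u \<and> last p = v \<and> walk E p \<and> inner_open E W p \<and> u \<notin> W \<and> v \<notin> W)"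
    (is "_ \<longleftrightarrow> ?R")
proof
  show "d_connected E W u v \<Longrightarrow> ?R"
    by (auto simp: d_connected_def is_path_def open_path_iff_inner_open)
  assume ?R
  then obtain p where p: "p \<noteq> []" "hd p = u" "last p = v" "walk E p" "inner_open E W p"
      "u \<notin> W" "v \<notin> W"
    by blast
  obtain p' where "p' \<noteq> []" "distinct p'" "walk E p'" "inner_open E W p'" "hd p' = u" "last p' = v"
    using walk_imp_path[OF assms p(1,4,5)] p(2,3) by blast
  then show "d_connected E W u v"
    using p by (auto simp: d_connected_def is_path_def open_path_iff_inner_open)
qed

lemma d_connected_obtain_path:
  assumes "d_connected E W u v" "u \<noteq> v"
  obtains a p where "walk E (u # a # p)" "inner_open E W (u # a # p)" "last (a # p) = v"
    "distinct (u # a # p)" "u \<notin> W" "v \<notin> W"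
proof -
  obtain q where q: "is_path E u q v" "open_path E W q"
    using assms by (auto simp: d_connected_def)
  obtain a p where "q = u # a # p"
    using q(1) assms(2) by (cases q; cases "tl q") (auto simp: is_path_def)
  then show thesis
    using q by (intro that[of a p]) (auto simp: is_path_def open_path_iff_inner_open)
qed

text \<open>Other nodes may repeat, but \<open>x\<close> must not recur: cutting a loop at
  \<open>x\<close> could remove the edge into \<open>x\<close>.\<close>

lemma confounding_iff_walk:
  assumes "acyclic E"
  shows "confounding E x y s B \<longleftrightarrow>
    (\<exists>a p. walk E (x # a # p) \<and> inner_open E (B \<union> {s}) (x # a # p) \<and> (a, x) \<in> E \<and>
       last (a # p) = y \<and> x \<notin> set (a # p) \<and> x \<notin> B \<union> {s} \<and> y \<notin> B \<union> {s})"
    (is "_ \<longleftrightarrow> ?R")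
proof
  assume "confounding E x y s B"
  then obtain q where q: "is_path E x q y" "2 \<le> length q" "(q ! 1, q ! 0) \<in> E"
      "open_path E (B \<union> {s}) q"
    by (auto simp: confounding_def backdoor_path_def)
  obtain a p where "q = x # a # p"
    using q(1,2) by (cases q; cases "tl q") (auto simp: is_path_def)
  then show ?R
    using q by (intro exI[of _ a] exI[of _ p]) (auto simp: is_path_def open_path_iff_inner_open)
next
  assume ?R
  then obtain a p where p: "walk E (x # a # p)" "inner_open E (B \<union> {s}) (x # a # p)"
      "(a, x) \<in> E" "last (a # p) = y" "x \<notin> set (a # p)" "x \<notin> B \<union> {s}" "y \<notin> B \<union> {s}"
    by blast
  obtain q where q: "q \<noteq> []" "distinct q" "walk E q" "inner_open E (B \<union> {s}) q" "hd q = x"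
      "last q = y" "take 2 q = [x, a]"
    using walk_imp_path[OF assms _ p(1,2)] p(4,5) by auto
  obtain q' where "q = x # a # q'"
    using q(7) by (cases q; cases "tl q") auto
  then have "backdoor_path E x q y" "open_path E (B \<union> {s}) q"
    using q p by (auto simp: backdoor_path_def is_path_def open_path_iff_inner_open)
  then show "confounding E x y s B"
    unfolding confounding_def by blast
qed

section \<open>Removing one node from the conditioning set\<close>

text \<open>The witness \<open>b\<close> is the last interior node blocked given \<open>W\<close>.
  As \<open>t\<close> unblocks it, it is a collider that reaches \<open>t\<close> but nothing in
  \<open>W\<close>.\<close>

lemma inner_open_insert_cases:
  assumes "inner_open E (insert t W) q"
  shows "inner_open E W q \<or>
    (\<exists>xs b c ys. q = xs @ b # c # ys \<and> xs \<noteq> [] \<and> (c, b) \<in> E \<and> inner_open E W (b # c # ys) \<and>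
       (b, t) \<in> E\<^sup>* \<and> (\<forall>d\<in>W. (b, d) \<notin> E\<^sup>*))"
  using assms
proof (induction E W q rule: inner_open.induct)
  case (1 E W a b c p)
  then consider "inner_open E W (b # c # p)" |
    xs b' c' ys where "b # c # p = xs @ b' # c' # ys" "(c', b') \<in> E" "inner_open E W (b' # c' # ys)"
       "(b', t) \<in> E\<^sup>*" "\<forall>d\<in>W. (b', d) \<notin> E\<^sup>*"
    by fastforce
  then show ?case
  proof cases
    case i: 1
    show ?thesis
    proof (cases "open_triple E W a b c")
      case True
      then show ?thesis using i by simp
    next
      case False
      then have "(c, b) \<in> E" "(b, t) \<in> E\<^sup>*" "\<forall>d\<in>W. (b, d) \<notin> E\<^sup>*"
        using 1(2) by (auto simp: open_triple_def split: if_splits)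
      moreover have "a # b # c # p = [a] @ b # c # p" by simp
      ultimately show ?thesis using i by blast
    qed
  next
    case 2
    then have "a # b # c # p = (a # xs) @ b' # c' # ys" by simp
    then show ?thesis using 2 by blast
  qed
qed auto

text \<open>A directed path from \<open>b\<close> to \<open>t\<close> is traversed backwards before
  the walk. Its nodes before \<open>t\<close> become non-colliders by acyclicity, and they avoid
  \<open>W\<close> because \<open>b\<close> reaches nothing there.\<close>

lemma walk_extend_descendant:
  assumes "acyclic E" "walk E (b # c # p)" "inner_open E W (b # c # p)" "(c, b) \<in> E"
    "(b, t) \<in> E\<^sup>*" "\<forall>d\<in>W. (b, d) \<notin> E\<^sup>*"
  shows "\<exists>d r. walk E (t # d # r) \<and> inner_open E W (t # d # r) \<and> (d, t) \<in> E \<and>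
           last (d # r) = last (c # p) \<and> set (d # r) \<subseteq> {n. (n, t) \<in> E\<^sup>+} \<union> set (c # p)"
  using assms(5)
proof (induction rule: rtrancl_induct)
  case base
  then show ?case using assms by blast
next
  case (step m n)
  then obtain d r where r: "walk E (m # d # r)" "inner_open E W (m # d # r)" "(d, m) \<in> E"
      "last (d # r) = last (c # p)" "set (d # r) \<subseteq> {n. (n, m) \<in> E\<^sup>+} \<union> set (c # p)"
    by blast
  have "(n, m) \<notin> E"
    using step(2) assms(1) by (meson acyclic_def r_into_trancl trancl_into_trancl)
  moreover have "m \<notin> W"
    using step(1) assms(6) by blast
  ultimately have "inner_open E W (n # m # d # r)"
    using r(2) by (simp add: open_triple_def)
  moreover have "set (m # d # r) \<subseteq> {k. (k, n) \<in> E\<^sup>+} \<union> set (c # p)"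
    using r(5) step(2) by (auto intro: trancl_into_trancl)
  ultimately show ?case
    using r(1,4) step(2) by (intro exI[of _ m] exI[of _ "d # r"]) auto
qed

text \<open>The bound on the visited nodes serves to show later that the new walk avoids the
  exposure after its start.\<close>

lemma walk_reroute:
  assumes "acyclic E" "walk E q" "inner_open E (insert t W) q"
  shows "inner_open E W q \<or>
    (\<exists>d r. walk E (t # d # r) \<and> inner_open E W (t # d # r) \<and> (d, t) \<in> E \<and>
       last (d # r) = last q \<and> set (d # r) \<subseteq> {n. (n, t) \<in> E\<^sup>+} \<union> set (tl q))"
  using inner_open_insert_cases[OF assms(3)]
proof (elim disjE exE conjE)
  fix xs b c ys
  assume q: "q = xs @ b # c # ys" "xs \<noteq> []" and b: "(c, b) \<in> E" "inner_open E W (b # c # ys)"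
    "(b, t) \<in> E\<^sup>*" "\<forall>d\<in>W. (b, d) \<notin> E\<^sup>*"
  have "walk E (b # c # ys)"
    using assms(2) unfolding q by (simp add: successively_append_iff)
  from walk_extend_descendant[OF assms(1) this b(2,1,3,4)]
  obtain d r where r: "walk E (t # d # r)" "inner_open E W (t # d # r)" "(d, t) \<in> E"
      "last (d # r) = last (c # ys)" "set (d # r) \<subseteq> {n. (n, t) \<in> E\<^sup>+} \<union> set (c # ys)"
    by blast
  moreover have "set (c # ys) \<subseteq> set (tl q)" "last q = last (c # ys)"
    using q by (cases xs; auto)+
  ultimately show ?thesis by (intro disjI2 exI[of _ d] exI[of _ r]) (auto simp del: set_simps)
qed simp

lemma walk_join:
  assumes "walk E (xs @ [e, z])" "walk E (z # b # q)"
    "inner_open E W (xs @ [e, z])" "inner_open E W (z # b # q)" "open_triple E W e z b"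
  shows "walk E ((xs @ [e, z]) @ b # q)" "inner_open E W ((xs @ [e, z]) @ b # q)"
  using assms by (auto simp: inner_open_append_triple successively_append_iff)

section \<open>Confounding and d-connection with the outcome\<close>

text \<open>Both walks visit \<open>x\<close> only at their start, so conditioning on
  \<open>x\<close> blocks nothing on them and opens the collider at which they are glued.\<close>

lemma confounding_imp_d_connected:
  assumes "acyclic E" "confounding E x y s B"
    and p: "walk E (x # a # p)" "inner_open E (B \<union> {s}) (x # a # p)" "(a, x) \<in> E"
      "last (a # p) = z" "x \<notin> set (a # p)" "z \<notin> B \<union> {s}"
    and "x \<noteq> y"
  shows "d_connected E (insert x (B \<union> {s})) z y"
proof -
  let ?W = "insert x (B \<union> {s})"
  obtain b q where q: "walk E (x # b # q)" "inner_open E (B \<union> {s}) (x # b # q)" "(b, x) \<in> E"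
      "last (b # q) = y" "x \<notin> set (b # q)" "y \<notin> B \<union> {s}"
    using assms(1,2) by (auto simp: confounding_iff_walk)
  have "inner_open E ?W (x # b # q)" "inner_open E ?W (x # a # p)"
    using inner_open_insert_notin_tl[OF q(2)] inner_open_insert_notin_tl[OF p(2)] q(5) p(5)
    by simp_all
  moreover from this(2) have "inner_open E ?W (rev p @ [a, x])"
    using inner_open_rev[of E ?W "x # a # p"] by simp
  moreover have "walk E (rev p @ [a, x])"
    using p(1) walk_rev[of E "x # a # p"] by simp
  moreover have "open_triple E ?W a x b"
    using p(3) q(3) by (auto simp: open_triple_def)
  ultimately have "walk E ((rev p @ [a, x]) @ b # q)" "inner_open E ?W ((rev p @ [a, x]) @ b # q)"
    using walk_join[of E "rev p" a x b q ?W] q(1) by blast+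
  moreover have "hd ((rev p @ [a, x]) @ b # q) = z"
    using p(4) by (cases p rule: rev_cases) auto
  moreover have "last ((rev p @ [a, x]) @ b # q) = y"
    using q(4) by simp
  moreover have "z \<noteq> x"
    using p(4,5) by (metis last_in_set list.distinct(1))
  ultimately show ?thesis
    unfolding d_connected_iff_walk[OF assms(1)] using p(6) q(6) assms(9)
    by (intro exI[of _ "(rev p @ [a, x]) @ b # q"]) auto
qed

text \<open>The rerouted walk consists of ancestors of \<open>z\<close> and later nodes of the
  backdoor walk. Neither include \<open>x\<close>, so conditioning on \<open>x\<close> does not
  block it.\<close>

lemma confounding_insert_imp:
  assumes "acyclic E" "confounding E x y s (insert z B)"
    and "(x, z) \<notin> E\<^sup>+" "x \<noteq> z" "z \<notin> B \<union> {s}" "x \<noteq> y"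
  shows "confounding E x y s B \<or> d_connected E (insert x (B \<union> {s})) z y"
proof -
  obtain b q where q: "walk E (x # b # q)" "inner_open E (insert z (B \<union> {s})) (x # b # q)"
      "(b, x) \<in> E" "last (b # q) = y" "x \<notin> set (b # q)"
      "x \<notin> B \<union> {s}" "y \<notin> B \<union> {s}" "y \<noteq> z"
    using assms(2) unfolding confounding_iff_walk[OF assms(1)] Un_insert_left by blast
  show ?thesis
    using walk_reroute[OF assms(1) q(1,2)]
  proof (elim disjE exE conjE)
    assume "inner_open E (B \<union> {s}) (x # b # q)"
    then have "confounding E x y s B"
      unfolding confounding_iff_walk[OF assms(1)] using q by blast
    then show ?thesis ..
  next
    fix d r
    assume r: "walk E (z # d # r)" "inner_open E (B \<union> {s}) (z # d # r)" "(d, z) \<in> E"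
      "last (d # r) = last (x # b # q)" "set (d # r) \<subseteq> {n. (n, z) \<in> E\<^sup>+} \<union> set (tl (x # b # q))"
    have "x \<notin> set (d # r)"
      using r(5) q(5) assms(3) by auto
    then have "inner_open E (insert x (B \<union> {s})) (z # d # r)"
      using inner_open_insert_notin_tl[OF r(2)] by simp
    then have "d_connected E (insert x (B \<union> {s})) z y"
      unfolding d_connected_iff_walk[OF assms(1)] using r(1,4) q assms(4-6)
      by (intro exI[of _ "z # d # r"]) auto
    then show ?thesis ..
  qed
qed

text \<open>Cut or rerouted walks give confounding given \<open>B\<close>; only gluing at
  \<open>z\<close> with \<open>z\<close> as a collider gives it given
  \<open>insert z B\<close>.\<close>

lemma d_connected_imp_confounding:
  assumes "acyclic E" "d_connected E (insert x (B \<union> {s})) z y"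
    and p: "walk E (x # a # p)" "inner_open E (B \<union> {s}) (x # a # p)" "(a, x) \<in> E"
      "last (a # p) = z" "distinct (x # a # p)" "x \<notin> B \<union> {s}" "z \<notin> B \<union> {s}"
    and "z \<noteq> y"
  shows "confounding E x y s B \<or> confounding E x y s (insert z B)"
proof -
  let ?W = "B \<union> {s}"
  obtain b q where q: "walk E (z # b # q)" "inner_open E (insert x ?W) (z # b # q)"
      "last (b # q) = y" "distinct (z # b # q)" "z \<notin> insert x ?W" "y \<notin> insert x ?W"
    using d_connected_obtain_path[OF assms(2) \<open>z \<noteq> y\<close>] .
  \<comment> \<open>By acyclicity \<open>x\<close> is not its own strict ancestor, so such a walk
    never returns to \<open>x\<close>.\<close>
  have via_x: ?thesis
    if "walk E (x # d # r)" "inner_open E ?W (x # d # r)" "(d, x) \<in> E" "last (d # r) = y"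
      "set (d # r) \<subseteq> {n. (n, x) \<in> E\<^sup>+} \<union> T" "x \<notin> T" for d r T
  proof -
    have "x \<notin> set (d # r)"
      using that(5,6) assms(1) by (auto simp: acyclic_def)
    then have "confounding E x y s B"
      unfolding confounding_iff_walk[OF assms(1)] using that p(6) q(6) by blast
    then show ?thesis ..
  qed
  show ?thesis
  \<comment> \<open>Since \<open>x\<close> is conditioned on, a visit to it must be a collider, so
    the remaining walk from \<open>x\<close> to \<open>y\<close> starts with an edge into
    \<open>x\<close>.\<close>
  proof (cases "x \<in> set (b # q)")
    case True
    then obtain l m where lm: "b # q = l @ x # m"
      by (meson split_list)
    then obtain f m' where m: "m = f # m'"
      using q(3,6) by (cases m) auto
    obtain l' e where l': "z # l = l' @ [e]"
      by (metis list.distinct(1) rev_exhaust)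
    have eq: "z # b # q = l' @ e # x # f # m'"
      using lm l' m by simp
    have x: "walk E (x # f # m')" "inner_open E (insert x ?W) (x # f # m')"
        "open_triple E (insert x ?W) e x f" "x \<notin> set (f # m')" "last (f # m') = y"
      using q(1,2,3,4) lm m unfolding eq
      by (auto simp: successively_append_iff inner_open_append_triple)
    have fx: "(f, x) \<in> E"
      using x(3) by (auto simp: open_triple_def split: if_splits)
    show ?thesis
      using walk_reroute[OF assms(1) x(1,2)] via_x[of f m' "set (f # m')"] via_x[of _ _ "set (f # m')"] x fx
      by auto
  next
    case False
    show ?thesis
      using walk_reroute[OF assms(1) q(1,2)]
    proof (elim disjE exE conjE)
      fix d r
      assume "walk E (x # d # r)" "inner_open E ?W (x # d # r)" "(d, x) \<in> E"
        "last (d # r) = last (z # b # q)" "set (d # r) \<subseteq> {n. (n, x) \<in> E\<^sup>+} \<union> set (tl (z # b # q))"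
      then show ?thesis
        using via_x[of d r "set (b # q)"] False q(3) by auto
    next
      assume ow: "inner_open E ?W (z # b # q)"
      obtain us where us: "a # p = us @ [z]"
        using p(4) by (metis append_butlast_last_id list.distinct(1))
      obtain xs e where "x # us = xs @ [e]"
        by (metis list.distinct(1) rev_exhaust)
      then have xs: "x # a # p = xs @ [e, z]"
        using us by simp
      \<comment> \<open>As \<open>z\<close> is only an endpoint of each of the two walks,
        conditioning on it blocks neither.\<close>
      have z_notin: "z \<notin> set (butlast (tl (x # a # p)))"
        using p(4,5) by (cases p rule: rev_cases) auto
      have joined: "confounding E x y s B'"
        if "open_triple E (B' \<union> {s}) e z b" "inner_open E (B' \<union> {s}) (x # a # p)"
          "inner_open E (B' \<union> {s}) (z # b # q)" "x \<notin> B' \<union> {s}" "y \<notin> B' \<union> {s}" for B'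
      proof -
        have "walk E ((x # a # p) @ b # q)" "inner_open E (B' \<union> {s}) ((x # a # p) @ b # q)"
          using walk_join[of E xs e z b q "B' \<union> {s}"] p(1) q(1) that(1-3) unfolding xs by blast+
        then show ?thesis
          unfolding confounding_iff_walk[OF assms(1)] using that(4,5) p(3,5) q(3) False
          by (intro exI[of _ a] exI[of _ "p @ b # q"]) auto
      qed
      show ?thesis
      proof (cases "(e, z) \<in> E \<and> (b, z) \<in> E")
        case True
        have "inner_open E (insert z ?W) (x # a # p)" "inner_open E (insert z ?W) (z # b # q)"
          using inner_open_insert[OF p(2) z_notin] inner_open_insert_notin_tl[OF ow, of z] q(4)
        by simp_all
        then have "confounding E x y s (insert z B)"
          using joined[of "insert z B"] True p(6) q(5,6) \<open>z \<noteq> y\<close>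
          by (auto simp: open_triple_def insert_commute)
        then show ?thesis ..
      next
        case False
        then have "confounding E x y s B"
          using joined[of B] p(2,6,7) q(6) ow by (auto simp: open_triple_def)
        then show ?thesis ..
      qed
    qed
  qed
qed

text \<open>
  If \<open>x\<close> causes \<open>s\<close>, rerouting towards \<open>s\<close> shows that the open walk needs no collider with
  descendant \<open>s\<close>.
\<close>

lemma open_path_enters_exposure:
  assumes "acyclic E" "d_connected E (B \<union> {s}) z x" "z \<noteq> x"
    and "\<forall>a\<in>insert z B. (x, a) \<notin> E\<^sup>+" "(x, s) \<notin> E\<^sup>+ \<or> \<not> d_connected E B s z" "s \<notin> B"
  obtains a p where "walk E (x # a # p)" "inner_open E (B \<union> {s}) (x # a # p)" "(a, x) \<in> E"
    "last (a # p) = z" "distinct (x # a # p)" "x \<notin> B \<union> {s}" "z \<notin> B \<union> {s}"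
proof -
  obtain b q where zx: "walk E (z # b # q)" "inner_open E (B \<union> {s}) (z # b # q)" "last (b # q) = x"
      "distinct (z # b # q)" "z \<notin> B \<union> {s}" "x \<notin> B \<union> {s}"
    using d_connected_obtain_path[OF assms(2,3)] .
  obtain a p where rq: "rev (z # b # q) = x # a # p"
    using zx(3) by (cases q rule: rev_cases; cases "rev (z # butlast (b # q))") auto
  have p: "walk E (x # a # p)" "inner_open E (B \<union> {s}) (x # a # p)" "distinct (x # a # p)"
    using zx unfolding rq[symmetric] by (simp_all only: walk_rev inner_open_rev distinct_rev)
  have "last (x # a # p) = z"
    unfolding rq[symmetric] by simp
  then have lz: "last (a # p) = z" by simp
  have "(a, x) \<in> E"
  proof (rule ccontr)
    assume "(a, x) \<notin> E"
    then have xa: "(x, a) \<in> E" using p(1) by auto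
    \<comment> \<open>Applied to \<open>B \<union> {s}\<close> this makes \<open>x\<close> a cause
      of \<open>s\<close>; applied to \<open>B\<close> it shows that the walk is open only thanks to
      \<open>s\<close>.\<close>
    have d: "\<not> inner_open E W (x # a # p)" if "\<forall>d\<in>W. (x, d) \<notin> E\<^sup>+" for W
      using walk_leaving_imp_causes[OF p(1) _ xa, of W] that lz assms(4) by auto
    then have "(x, s) \<in> E\<^sup>+"
      using p(2) assms(4) by auto
    moreover have "d_connected E B s z"
    proof -
      have "\<not> inner_open E B (x # a # p)" "inner_open E (insert s B) (x # a # p)"
        using d[of B] assms(4) p(2) by auto
      then obtain d r where "walk E (s # d # r)" "inner_open E B (s # d # r)"
          "last (d # r) = last (x # a # p)"
        using walk_reroute[OF assms(1) p(1)] by blast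
      then show ?thesis
        unfolding d_connected_iff_walk[OF assms(1)] using lz zx(5) assms(6)
        by (intro exI[of _ "s # d # r"]) auto
    qed
    ultimately show False using assms(5) by blast
  qed
  then show thesis using that p lz zx(5,6) by blast
qed

section \<open>The adjustment theorem\<close>

lemma (in causal_model) cond_dep_iff_d_connected:
  assumes "faithful M N R V E" "u \<in> V" "v \<in> V" "u \<noteq> v" "finite W" "W \<subseteq> V - {u, v}"
  shows "cond_dep M N R W u v \<longleftrightarrow> d_connected E W u v"
  using assms(1)[unfolded faithful_def, rule_format, OF assms(2-6)] markov[OF assms(2-6)] by blast

theorem theorem1:
  fixes M :: "'w measure" and N :: "'v \<Rightarrow> 'b measure" and R :: "'v \<Rightarrow> 'w \<Rightarrow> 'b"
    and V :: "'v set" and E :: "('v \<times> 'v) set"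
    and X Y S :: 'v and A Z :: "'v set"
  assumes model: "causal_model M N R V E"
    and nodes: "X \<in> V" "Y \<in> V" "S \<in> V" "A \<subseteq> V" "finite A"
    and distinct_nodes: "X \<noteq> Y" "X \<notin> A" "Y \<notin> A" "S \<notin> A \<union> {X, Y}"
    and outcome_not_cause: "\<not> causes E Y X"
    and covariates_not_caused: "\<forall>a \<in> A. \<not> causes E X a"
    and selection:
      "\<not> causes E X S \<or>
       (\<forall>z \<in> A. cond_dep M N R (A - {z} \<union> {S}) z X \<longrightarrow> cond_indep M N R (A - {z}) S z)"
    and faithfulness: "faithful M N R V E"
    and Z: "Z \<noteq> {}" "Z \<subseteq> A"
    and Z_dep_X: "\<forall>z \<in> Z. cond_dep M N R (A - {z} \<union> {S}) z X"
  shows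
    "((\<forall>z \<in> Z. cond_dep M N R (A - {z} \<union> {X} \<union> {S}) z Y) \<longrightarrow>
        \<not> valid_adjustment E X Y S A A \<or>
        (\<forall>z \<in> Z. valid_adjustment E X Y S A A \<and> \<not> valid_adjustment E X Y S A (A - {z}))) \<and>
     ((\<exists>z \<in> Z. cond_indep M N R (A - {z} \<union> {X} \<union> {S}) z Y) \<longrightarrow>
        valid_adjustment E X Y S A A \<and>
        (\<exists>B. B \<subset> A \<and> valid_adjustment E X Y S A B) \<and>
        (\<forall>z \<in> Z. cond_indep M N R (A - {z} \<union> {X} \<union> {S}) z Y \<longrightarrow>
           valid_adjustment E X Y S A (A - {z})))"
proof -
  interpret causal_model M N R V E by (rule model)
  note dep_iff = cond_dep_iff_d_connected[OF faithfulness]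
  have acyc: "acyclic E" by (rule dag)
  {
    fix z assume z: "z \<in> Z"
    let ?B = "A - {z}"
    let ?W = "?B \<union> {S}"
    have zA: "z \<in> A" and zV: "z \<in> V" and neq: "z \<noteq> X" "z \<noteq> Y" "z \<notin> ?W"
      using z Z(2) nodes distinct_nodes by auto
    have "S \<noteq> z" using zA distinct_nodes by auto
    then have sub: "?W \<subseteq> V - {z, X}" "?B \<subseteq> V - {S, z}" "insert X ?W \<subseteq> V - {z, Y}"
      and fin: "finite ?W" "finite ?B" "finite (insert X ?W)"
      using zA nodes distinct_nodes by auto
    have zx: "d_connected E ?W z X"
      using Z_dep_X z dep_iff[OF zV nodes(1) neq(1) fin(1) sub(1)] by blast
    \<comment> \<open>The eligibility condition on \<open>z\<close> in the selection assumption is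
      exactly the dependence assumed for elements of \<open>Z\<close>.\<close>
    have sel: "(X, S) \<notin> E\<^sup>+ \<or> \<not> d_connected E ?B S z"
      using selection Z_dep_X z zA dep_iff[OF nodes(3) zV \<open>S \<noteq> z\<close> fin(2) sub(2)]
      unfolding causes_def by blast
    have desc: "\<forall>a\<in>insert z ?B. (X, a) \<notin> E\<^sup>+" and SB: "S \<notin> ?B"
      using covariates_not_caused zA distinct_nodes unfolding causes_def by auto
    obtain a p where p: "walk E (X # a # p)" "inner_open E ?W (X # a # p)" "(a, X) \<in> E"
      "last (a # p) = z" "distinct (X # a # p)" "X \<notin> ?W" "z \<notin> ?W"
      using open_path_enters_exposure[OF acyc zx neq(1) desc sel SB] .
    have dep: "cond_dep M N R (?B \<union> {X} \<union> {S}) z Y \<longleftrightarrow> d_connected E (insert X ?W) z Y"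
      using dep_iff[OF zV nodes(2) neq(2) fin(3) sub(3)] by (simp add: insert_commute)
    have A: "insert z ?B = A" using zA by blast
    have "cond_dep M N R (?B \<union> {X} \<union> {S}) z Y \<Longrightarrow>
        confounding E X Y S ?B \<or> confounding E X Y S A"
      using d_connected_imp_confounding[OF acyc _ p neq(2)] dep A by simp
    moreover have "confounding E X Y S ?B \<Longrightarrow> cond_dep M N R (?B \<union> {X} \<union> {S}) z Y"
      using confounding_imp_d_connected[OF acyc _ p(1-4) _ p(7) distinct_nodes(1)] p(5) dep by simp
    moreover have "confounding E X Y S A \<Longrightarrow>
        confounding E X Y S ?B \<or> cond_dep M N R (?B \<union> {X} \<union> {S}) z Y"
      using confounding_insert_imp[OF acyc, of X Y S z ?B] covariates_not_caused zA neq
        distinct_nodes(1) A dep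
      unfolding causes_def by auto
    \<comment> \<open>Together: \<open>z\<close> and \<open>Y\<close> are dependent exactly when at
      least one of \<open>A - {z}\<close> and \<open>A\<close> leaves confounding.\<close>
    ultimately have
      "cond_dep M N R (?B \<union> {X} \<union> {S}) z Y \<Longrightarrow> confounding E X Y S ?B \<or> confounding E X Y S A"
      "cond_indep M N R (?B \<union> {X} \<union> {S}) z Y \<Longrightarrow>
         \<not> confounding E X Y S ?B \<and> \<not> confounding E X Y S A"
      by blast+
  }
  note main = this
  show ?thesis
  proof (intro conjI impI)
    assume "\<forall>z\<in>Z. cond_dep M N R (A - {z} \<union> {X} \<union> {S}) z Y"
    then show "\<not> valid_adjustment E X Y S A A \<or>
        (\<forall>z \<in> Z. valid_adjustment E X Y S A A \<and> \<not> valid_adjustment E X Y S A (A - {z}))"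
      using main(1) unfolding valid_adjustment_def by blast
  next
    assume "\<exists>z\<in>Z. cond_indep M N R (A - {z} \<union> {X} \<union> {S}) z Y"
    then obtain z where z: "z \<in> Z" "cond_indep M N R (A - {z} \<union> {X} \<union> {S}) z Y" by blast
    show "valid_adjustment E X Y S A A"
      using main(2)[OF z] unfolding valid_adjustment_def by blast
    have "A - {z} \<subset> A" "valid_adjustment E X Y S A (A - {z})"
      using main(2)[OF z] z(1) Z(2) unfolding valid_adjustment_def by blast+
    then show "\<exists>B. B \<subset> A \<and> valid_adjustment E X Y S A B" by blast
    show "\<forall>z \<in> Z. cond_indep M N R (A - {z} \<union> {X} \<union> {S}) z Y \<longrightarrow>
        valid_adjustment E X Y S A (A - {z})"
      using main(2) unfolding valid_adjustment_def by blast
  qed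
qed

end
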